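(* For any admissible sequence $(f_n)_{n\in\omega}$, the family $\mathrm{Micro}_{(f_n)_n}^{\star}$ of all sets $A\subseteq\mathbb{R}$ that can be covered by an $\mathbf{F_\sigma}$ set which is $(f_n)_n$-microscopic forms a $\sigma$-ideal (i.e., it is closed under taking subsets and under countable unions).
   Context: $\omega=\{0,1,2,\ldots\}$; $|J|$ denotes the length of an interval $J\subseteq\mathbb{R}$. An admissible sequence is a nonincreasing sequence $(f_n)_{n\in\omega}$ of functions $f_n\colon(0,1)\to(0,1)$ (i.e. $f_{n+1}(x)\le f_n(x)$ for all $n$ and $x$) such that: each $f_n$ is increasing; $\lim_{x\to0^+}f_n(x)=0$ for all $n$; and there exists $x_0$ such that for every $x\in(0,x_0)$ the series $\sum_{n\in\omega}f_n(x)$ converges. A set $M\subseteq\mathbb{R}$ is called $(f_n)_n$-microscopic if for every $\varepsilon\in(0,1)$ there is a sequence of intervals $(I_k)_{k\in\omega}$ such that $M\subseteq\bigcup_k I_k$ and $|I_k|\le f_k(\varepsilon)$ for all $k\in\omega$. The family of all $(f_n)_n$-microscopic sets is denoted $\mathrm{Micro}_{(f_n)_n}$. For a family $\mathcal{A}$ of subsets of $\mathbb{R}$, $\mathcal{A}^{\star}$ denotes the family of all sets that can be covered by (are contained in) an $\mathbf{F_\sigma}$ set belonging to $\mathcal{A}$. *)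

theory Defs
  imports "HOL-Analysis.Analysis"
begin

text \<open>Functions \<open>(0,1) \<rightarrow> (0,1)\<close> are total functions on \<^typ>\<open>real\<close> of which only the
  values on \<^term>\<open>{0<..<1::real}\<close> matter. ``Increasing'' is read strictly (as opposed to
  ``nonincreasing'', which is used for the weak order).\<close>

definition admissible :: "(nat \<Rightarrow> real \<Rightarrow> real) \<Rightarrow> bool" where
  "admissible f \<longleftrightarrow>
     (\<forall>n. f n \<in> {0<..<1} \<rightarrow> {0<..<1}) \<and>
     (\<forall>n. \<forall>x\<in>{0<..<1}. f (Suc n) x \<le> f n x) \<and>
     (\<forall>n. strict_mono_on {0<..<1} (f n)) \<and>
     (\<forall>n. (f n \<longlongrightarrow> 0) (at_right 0)) \<and>
     (\<exists>x0\<in>{0<..<1}. \<forall>x\<in>{0<..<x0}. summable (\<lambda>n. f n x))"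

text \<open>Intervals may be open, closed, half-open or degenerate. Their length is Lebesgue measure
  in \<^typ>\<open>ennreal\<close>, so that unbounded intervals have length \<open>\<infinity>\<close> and are excluded by the
  length bound.\<close>

definition microscopic :: "(nat \<Rightarrow> real \<Rightarrow> real) \<Rightarrow> real set \<Rightarrow> bool" where
  "microscopic f M \<longleftrightarrow>
     (\<forall>\<epsilon>\<in>{0<..<1}. \<exists>I :: nat \<Rightarrow> real set.
        (\<forall>k. is_interval (I k)) \<and>
        M \<subseteq> (\<Union>k. I k) \<and>
        (\<forall>k. emeasure lborel (I k) \<le> ennreal (f k \<epsilon>)))"

definition Micro :: "(nat \<Rightarrow> real \<Rightarrow> real) \<Rightarrow> real set set" where
  "Micro f = {M. microscopic f M}"

definition fsigma_star :: "real set set \<Rightarrow> real set set" where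
  "fsigma_star \<A> = {A. \<exists>F. fsigma F \<and> F \<in> \<A> \<and> A \<subseteq> F}"

definition sigma_ideal :: "'a set set \<Rightarrow> bool" where
  "sigma_ideal \<I> \<longleftrightarrow>
     {} \<in> \<I> \<and>
     (\<forall>A\<in>\<I>. \<forall>B\<subseteq>A. B \<in> \<I>) \<and>
     (\<forall>A :: nat \<Rightarrow> 'a set. range A \<subseteq> \<I> \<longrightarrow> (\<Union>n. A n) \<in> \<I>)"

end

theory Submission
  imports Defs
begin

text \<open>
  An \<open>F\<^sub>\<sigma>\<close> set is a countable union of compact sets, so it suffices that a countable union of
  compact microscopic sets is microscopic. This follows once every compact microscopic \<open>K\<close> can,
  for all \<open>M\<close> and \<open>\<epsilon>\<close>, be covered using only the lengths \<open>f\<^sub>k(\<epsilon>)\<close> with \<open>k \<ge> M\<close>: by compactness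
  finitely many \<open>k\<close> suffice, and the pieces of the union get consecutive blocks of indices.

  Suppose this fails for \<open>K\<close>, \<open>M\<close>, \<open>\<epsilon>\<close>. For \<open>\<delta> \<le> \<epsilon>\<close> cover \<open>K\<close> by \<open>N\<close> intervals of lengths
  \<open>f\<^sub>k(\<delta>)\<close>, and let \<open>U\<close> be the union of the first \<open>M\<close> of them. Given \<open>n \<ge> N\<close>, take \<open>\<eta>\<close> so small
  that \<open>f\<^sub>0(\<eta>) < f\<^sub>n(\<epsilon>)\<close>; in a cover of \<open>K\<close> by intervals of lengths \<open>f\<^sub>k(\<eta>)\<close>, those with
  \<open>k < n\<close> may be given any index below \<open>n\<close>. If at most \<open>n - N\<close> of them met \<open>U\<close>, these would fit
  into the indices \<open>N, \<dots>, n - 1\<close>, so that \<open>K \<inter> U\<close> needs only indices from \<open>N\<close> on, while \<open>K - U\<close>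
  is covered by the indices \<open>M, \<dots>, N - 1\<close>: a contradiction. Hence fewer than \<open>N\<close> of them miss
  \<open>U\<close>. As \<open>N\<close> does not depend on \<open>n\<close>, the part of \<open>K\<close> away from \<open>U\<close> can be covered with indices
  from an arbitrarily late finite block. As \<open>\<delta> \<rightarrow> 0\<close>, these parts exhaust \<open>K\<close> up to a finite set,
  since the neighbourhoods of \<open>U\<close> consist of \<open>M\<close> intervals whose lengths tend to \<open>0\<close>.
  So \<open>K\<close> is covered by indices \<open>\<ge> M\<close> after all.
\<close>

section \<open>Coverings by closed intervals of prescribed lengths\<close>

text \<open>Keeping the index set \<open>S\<close> explicit allows disjoint sets of indices to be
  spent on different pieces of a set.\<close>

definition coverable :: "(nat \<Rightarrow> real) \<Rightarrow> nat set \<Rightarrow> real set \<Rightarrow> bool" where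
  "coverable r S A \<longleftrightarrow> (\<exists>c. A \<subseteq> (\<Union>k\<in>S. {c k..c k + r k}))"

lemma coverable_mono:
  assumes "coverable r S A" "S \<subseteq> T" "B \<subseteq> A" "\<And>k. k \<in> S \<Longrightarrow> r k \<le> s k"
  shows "coverable s T B"
proof -
  obtain c where c: "A \<subseteq> (\<Union>k\<in>S. {c k..c k + r k})"
    using assms(1) unfolding coverable_def by blast
  have "(\<Union>k\<in>S. {c k..c k + r k}) \<subseteq> (\<Union>k\<in>T. {c k..c k + s k})"
    by (rule UN_mono) (use assms(2,4) in auto)
  with c assms(3) have "B \<subseteq> (\<Union>k\<in>T. {c k..c k + s k})" by (meson order_trans)
  then show ?thesis unfolding coverable_def by (rule exI[where x = c])
qed

lemma coverable_Un:
  assumes "coverable r S A" "coverable r T B" "S \<inter> T = {}"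
  shows "coverable r (S \<union> T) (A \<union> B)"
proof -
  obtain c d where c: "A \<subseteq> (\<Union>k\<in>S. {c k..c k + r k})" and d: "B \<subseteq> (\<Union>k\<in>T. {d k..d k + r k})"
    using assms(1,2) unfolding coverable_def by blast
  let ?e = "\<lambda>k. if k \<in> S then c k else d k"
  have "(\<Union>k\<in>S. {c k..c k + r k}) = (\<Union>k\<in>S. {?e k..?e k + r k})"
    by auto
  moreover have "(\<Union>k\<in>T. {d k..d k + r k}) = (\<Union>k\<in>T. {?e k..?e k + r k})"
    using assms(3) by (intro SUP_cong) auto
  ultimately have "A \<union> B \<subseteq> (\<Union>k\<in>S \<union> T. {?e k..?e k + r k})"
    using Un_mono[OF c d] by (simp only: UN_Un)
  then show ?thesis unfolding coverable_def by (rule exI[where x = ?e])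
qed

lemma coverable_UN:
  fixes S :: "nat \<Rightarrow> nat set"
  assumes "\<And>i. coverable r (S i) (A i)" "disjoint_family S"
  shows "coverable r (\<Union>i. S i) (\<Union>i. A i)"
proof -
  obtain c where c: "\<And>i. A i \<subseteq> (\<Union>k\<in>S i. {c i k..c i k + r k})"
    using assms(1) unfolding coverable_def by metis
  \<comment> \<open>By disjointness \<open>?i k\<close> is the only \<open>i\<close> with
    \<open>k \<in> S i\<close>, so the families \<open>c i\<close> glue to a single one.\<close>
  let ?i = "\<lambda>k. SOME i. k \<in> S i"
  have i: "?i k = i" if "k \<in> S i" for i k
  proof -
    have "k \<in> S (?i k)" using that by (rule someI)
    with that assms(2) show ?thesis by (auto simp: disjoint_family_on_def)
  qed
  have "(\<Union>i. A i) \<subseteq> (\<Union>k\<in>\<Union>i. S i. {c (?i k) k..c (?i k) k + r k})"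
  proof
    fix x assume "x \<in> (\<Union>i. A i)"
    then obtain i k where "k \<in> S i" "x \<in> {c i k..c i k + r k}" using c by blast
    with i[of k i] show "x \<in> (\<Union>k\<in>\<Union>i. S i. {c (?i k) k..c (?i k) k + r k})" by auto
  qed
  then show ?thesis unfolding coverable_def by (rule exI[where x = "\<lambda>k. c (?i k) k"])
qed

text \<open>Greedy choice: the block for each member starts where the previous one ends. That end is
  not under control, so \<open>block\<close> has to allow every starting index
  \<open>m\<close>.\<close>

lemma coverable_countable_Union:
  assumes "countable \<A>"
    and block: "\<And>A m. A \<in> \<A> \<Longrightarrow> \<exists>m'. coverable r {m..<m'} A"
  shows "coverable r {M..} (\<Union>\<A>)"
proof (cases "\<A> = {}")
  case True
  then show ?thesis by (simp add: coverable_def)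
next
  case False
  let ?A = "from_nat_into \<A>"
  have "\<exists>m'\<ge>m. coverable r {m..<m'} (?A i)" for i m
  proof -
    obtain m' where "coverable r {m..<m'} (?A i)"
      using block from_nat_into[OF False] by blast
    \<comment> \<open>With \<open>m \<le> m'\<close> the block boundaries \<open>b\<close> are
      monotone even when a block is empty.\<close>
    then have "coverable r {m..<max m m'} (?A i)"
      by (rule coverable_mono) auto
    then show ?thesis by (metis max.cobounded1)
  qed
  then have "\<forall>i. \<forall>m. \<exists>m'. m \<le> m' \<and> coverable r {m..<m'} (?A i)" by blast
  then obtain g where g: "\<And>i m. m \<le> g i m" "\<And>i m. coverable r {m..<g i m} (?A i)"
    unfolding choice_iff by blast
  define b where "b = rec_nat M g"
  have b: "b 0 = M" "b (Suc i) = g i (b i)" for i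
    by (simp_all add: b_def)
  have mono: "mono b"
    by (rule mono_iff_le_Suc[THEN iffD2]) (simp add: b g)
  have "coverable r (\<Union>i. {b i..<b (Suc i)}) (\<Union>i. ?A i)"
  proof (rule coverable_UN)
    show "coverable r {b i..<b (Suc i)} (?A i)" for i
      using g(2)[of "b i" i] by (simp add: b)
    show "disjoint_family (\<lambda>i. {b i..<b (Suc i)})"
      unfolding disjoint_family_on_def
    proof (intro ballI impI)
      fix i j :: nat assume "i \<noteq> j"
      then have "b (Suc i) \<le> b j \<or> b (Suc j) \<le> b i"
        using monoD[OF mono, of "Suc i" j] monoD[OF mono, of "Suc j" i] by linarith
      then show "{b i..<b (Suc i)} \<inter> {b j..<b (Suc j)} = {}" by auto
    qed
  qed
  moreover have "M \<le> b i" for i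
    using monoD[OF mono, of 0 i] b(1) by simp
  then have "(\<Union>i. {b i..<b (Suc i)}) \<subseteq> {M..}"
    by (auto intro: order_trans[OF \<open>\<And>i. M \<le> b i\<close>])
  moreover have "(\<Union>i. ?A i) = \<Union>\<A>"
    using range_from_nat_into[OF False assms(1)] by simp
  ultimately show ?thesis
    by (auto intro: coverable_mono)
qed

text \<open>The slack \<open>s k - r k\<close> lets each closed interval grow to an open one,
  concentric with it and of length \<open>s k\<close>; compactness then leaves finitely many
  indices.\<close>

lemma coverable_compact:
  assumes "compact K" "coverable r S K" "\<And>k. k \<in> S \<Longrightarrow> r k < s k"
  shows "\<exists>N. coverable s (S \<inter> {..<N}) K"
proof -
  obtain c where c: "K \<subseteq> (\<Union>k\<in>S. {c k..c k + r k})"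
    using assms(2) unfolding coverable_def by blast
  let ?d = "\<lambda>k. c k - (s k - r k) / 2"
  let ?J = "\<lambda>k. {?d k<..<?d k + s k}"
  have "(\<Union>k\<in>S. {c k..c k + r k}) \<subseteq> (\<Union>k\<in>S. ?J k)"
    by (rule UN_mono) (auto dest!: assms(3) simp: field_simps)
  with c have cov: "K \<subseteq> (\<Union>k\<in>S. ?J k)" by (rule order_trans)
  obtain D where D: "D \<subseteq> S" "finite D" "K \<subseteq> (\<Union>k\<in>D. ?J k)"
    by (rule compactE_image[OF assms(1) _ cov]) auto
  obtain N where N: "D \<subseteq> {..<N}"
    using D(2) finite_nat_iff_bounded by blast
  have "K \<subseteq> (\<Union>k\<in>S \<inter> {..<N}. {?d k..?d k + s k})"
    by (rule order_trans[OF D(3)], rule UN_mono) (use D(1) N in auto)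
  then show ?thesis unfolding coverable_def by (intro exI[of _ N] exI[of _ ?d])
qed

text \<open>The common length \<open>e\<close> fits at every index of \<open>T\<close>, so only the
  number of intervals matters.\<close>

lemma coverable_reindex:
  assumes "finite J" "finite T" "card J \<le> card T"
    and "A \<subseteq> (\<Union>k\<in>J. {c k..c k + e})" "\<And>t. t \<in> T \<Longrightarrow> e \<le> r t"
  shows "coverable r T A"
proof -
  obtain h where h: "inj_on h J" "h ` J \<subseteq> T"
    using assms(1-3) by (metis card_le_inj)
  let ?d = "\<lambda>t. c (inv_into J h t)"
  have "A \<subseteq> (\<Union>t\<in>T. {?d t..?d t + r t})"
  proof
    fix x assume "x \<in> A"
    then obtain k where k: "k \<in> J" "x \<in> {c k..c k + e}" using assms(4) by blast
    then have "x \<in> {?d (h k)..?d (h k) + r (h k)}"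
      using h assms(5)[of "h k"] by auto
    with k h show "x \<in> (\<Union>t\<in>T. {?d t..?d t + r t})" by blast
  qed
  then show ?thesis unfolding coverable_def by (rule exI[where x = ?d])
qed

section \<open>Microscopic sets through closed intervals\<close>

text \<open>Two points of \<open>I\<close> more than \<open>r\<close> apart would span a segment
  inside \<open>I\<close> of measure above \<open>r\<close>. Hence \<open>Inf I\<close> serves as
  left endpoint.\<close>

lemma is_interval_subset_Icc:
  fixes I :: "real set"
  assumes "is_interval I" "emeasure lborel I \<le> ennreal r" "0 \<le> r"
  shows "\<exists>a. I \<subseteq> {a..a + r}"
proof (cases "I = {}")
  case False
  have le: "y \<le> x + r" if "x \<in> I" "y \<in> I" for x y
  proof (rule ccontr)
    assume "\<not> y \<le> x + r"
    then have "r < y - x" by simp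
    have "{x..y} \<subseteq> I"
      using mem_is_interval_1_I[OF assms(1) that] by auto
    then have "emeasure lborel {x..y} \<le> emeasure lborel I"
      by (rule emeasure_mono) (simp add: real_interval_borel_measurable[OF assms(1)])
    also have "\<dots> \<le> ennreal r" by (rule assms(2))
    finally have "ennreal (y - x) \<le> ennreal r"
      using \<open>r < y - x\<close> assms(3) by simp
    then show False using \<open>r < y - x\<close> assms(3) by (simp add: ennreal_le_iff)
  qed
  obtain x0 where "x0 \<in> I" using False by blast
  then have bdd: "bdd_below I"
    by (intro bdd_belowI[of _ "x0 - r"]) (use le in force)
  have "I \<subseteq> {Inf I..Inf I + r}"
  proof
    fix y assume y: "y \<in> I"
    have "y - r \<le> Inf I"
      by (rule cInf_greatest[OF False]) (use le[OF _ y] in force)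
    with cInf_lower[OF y bdd] show "y \<in> {Inf I..Inf I + r}" by auto
  qed
  then show ?thesis ..
qed simp

lemma admissibleD:
  assumes "admissible f"
  shows admissible_pos: "x \<in> {0<..<1} \<Longrightarrow> 0 < f n x"
    and admissible_antimono: "x \<in> {0<..<1} \<Longrightarrow> m \<le> n \<Longrightarrow> f n x \<le> f m x"
    and admissible_strict_mono: "x \<in> {0<..<1} \<Longrightarrow> y \<in> {0<..<1} \<Longrightarrow> x < y \<Longrightarrow> f n x < f n y"
    and admissible_mono: "x \<in> {0<..<1} \<Longrightarrow> y \<in> {0<..<1} \<Longrightarrow> x \<le> y \<Longrightarrow> f n x \<le> f n y"
    and admissible_tendsto: "(f n \<longlongrightarrow> 0) (at_right 0)"
proof -
  show "0 < f n x" if "x \<in> {0<..<1}"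
    using assms that unfolding admissible_def by fastforce
  show "f n x \<le> f m x" if "x \<in> {0<..<1}" "m \<le> n"
    using lift_Suc_antimono_le[of "\<lambda>n. f n x", OF _ that(2)] assms that(1)
    unfolding admissible_def by blast
  show strict: "f n x < f n y" if "x \<in> {0<..<1}" "y \<in> {0<..<1}" "x < y" for x y
    using assms that unfolding admissible_def by (metis strict_mono_onD)
  show "f n x \<le> f n y" if "x \<in> {0<..<1}" "y \<in> {0<..<1}" "x \<le> y"
    using strict[OF that(1,2)] that(3) by (cases "x = y") auto
  show "(f n \<longlongrightarrow> 0) (at_right 0)"
    using assms unfolding admissible_def by blast
qed

lemma microscopic_iff_coverable:
  assumes "admissible f"
  shows "microscopic f A \<longleftrightarrow> (\<forall>\<epsilon>\<in>{0<..<1}. coverable (\<lambda>k. f k \<epsilon>) UNIV A)"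
  unfolding microscopic_def
proof (rule ball_cong[OF refl])
  fix \<epsilon> :: real assume \<epsilon>: "\<epsilon> \<in> {0<..<1}"
  note pos = admissible_pos[OF assms \<epsilon>, THEN less_imp_le]
  show "(\<exists>I. (\<forall>k. is_interval (I k)) \<and> A \<subseteq> (\<Union>k. I k) \<and>
          (\<forall>k. emeasure lborel (I k) \<le> ennreal (f k \<epsilon>))) \<longleftrightarrow> coverable (\<lambda>k. f k \<epsilon>) UNIV A"
    (is "?L \<longleftrightarrow> ?R")
  proof
    assume ?L
    then obtain I where I: "\<And>k. is_interval (I k)" "A \<subseteq> (\<Union>k. I k)"
        "\<And>k. emeasure lborel (I k) \<le> ennreal (f k \<epsilon>)" by blast
    obtain c where "\<And>k. I k \<subseteq> {c k..c k + f k \<epsilon>}"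
      using is_interval_subset_Icc[OF I(1,3) pos] by metis
    then have "(\<Union>k. I k) \<subseteq> (\<Union>k. {c k..c k + f k \<epsilon>})" by (rule SUP_mono')
    with I(2) show ?R unfolding coverable_def by (intro exI[of _ c]) (rule order_trans)
  next
    assume ?R
    then obtain c where c: "A \<subseteq> (\<Union>k. {c k..c k + f k \<epsilon>})" unfolding coverable_def by blast
    show ?L
      by (rule exI[where x = "\<lambda>k. {c k..c k + f k \<epsilon>}"]) (use c pos in \<open>auto simp: is_interval_cc\<close>)
  qed
qed

section \<open>Compact microscopic sets and late indices\<close>

text \<open>Of \<open>M + 1\<close> points in the intersection, two share one of the
  \<open>M\<close> intervals at each stage \<open>i\<close>. This is impossible once
  \<open>e i\<close> is below all their mutual distances.\<close>

lemma finite_INT_short_intervals: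
  fixes c :: "nat \<Rightarrow> nat \<Rightarrow> real"
  assumes "e \<longlonglongrightarrow> 0"
  shows "finite (\<Inter>i. \<Union>k<M. {c i k..c i k + e i})"
proof (rule ccontr)
  assume "infinite (\<Inter>i. \<Union>k<M. {c i k..c i k + e i})"
  then obtain Q where Q: "finite Q" "card Q = Suc M" "Q \<subseteq> (\<Inter>i. \<Union>k<M. {c i k..c i k + e i})"
    using infinite_arbitrarily_large by blast
  define D where "D = (\<lambda>(x, y). \<bar>x - y\<bar>) ` {(x, y). x \<in> Q \<and> y \<in> Q \<and> x \<noteq> y}"
  have "{(x, y). x \<in> Q \<and> y \<in> Q \<and> x \<noteq> y} \<subseteq> Q \<times> Q" by auto
  then have finD: "finite D"
    unfolding D_def using Q(1) finite_subset finite_SigmaI by blast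
  have "\<forall>\<^sub>F i in sequentially. \<forall>d\<in>D. e i < d"
  proof (rule eventually_ball_finite[OF finD], rule ballI)
    fix d assume "d \<in> D"
    then have "0 < d" by (auto simp: D_def)
    with assms show "\<forall>\<^sub>F i in sequentially. e i < d" by (rule order_tendstoD(2))
  qed
  then obtain i where i: "\<forall>d\<in>D. e i < d"
    using eventually_happens by force
  have "\<exists>h. \<forall>x\<in>Q. h x < M \<and> x \<in> {c i (h x)..c i (h x) + e i}"
    by (rule bchoice) (use Q(3) in blast)
  then obtain h where h: "\<And>x. x \<in> Q \<Longrightarrow> h x < M" "\<And>x. x \<in> Q \<Longrightarrow> x \<in> {c i (h x)..c i (h x) + e i}"
    by blast
  have "card (h ` Q) < card Q"
    using card_mono[of "{..<M}" "h ` Q"] h(1) Q(2) by (simp add: image_subsetI)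
  then obtain x y where xy: "x \<in> Q" "y \<in> Q" "x \<noteq> y" "h x = h y"
    using pigeonhole unfolding inj_on_def by blast
  then have "\<bar>x - y\<bar> \<le> e i"
    using h(2)[of x] h(2)[of y] by auto
  moreover have "\<bar>x - y\<bar> \<in> D"
    unfolding D_def using xy by force
  ultimately show False using i by force
qed

text \<open>The counting argument for a fixed \<delta>. It matters that \<open>c\<close> is chosen
  before \<open>m\<close>: one neighbourhood of \<open>U\<close> serves for all starting
  indices.\<close>

lemma coverable_blocks_away:
  assumes adm: "admissible f" and \<epsilon>: "\<epsilon> \<in> {0<..<1}" and \<delta>: "\<delta> \<in> {0<..\<epsilon>}"
    and fin: "\<And>\<eta>. \<eta> \<in> {0<..<1} \<Longrightarrow> \<exists>N. coverable (\<lambda>k. f k \<eta>) {..<N} K"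
    and neg: "\<not> coverable (\<lambda>k. f k \<epsilon>) {M..} K"
  shows "\<exists>c. \<forall>m. \<exists>m'. coverable (\<lambda>k. f k \<epsilon>) {m..<m'}
    (K - (\<Union>k<M. {c k..c k + (f 0 \<delta> + 2 * \<delta>)}))"
proof -
  have \<delta>1: "\<delta> \<in> {0<..<1}" using \<epsilon> \<delta> by auto
  obtain N0 where "coverable (\<lambda>k. f k \<delta>) {..<N0} K" using fin[OF \<delta>1] by blast
  then obtain c where "K \<subseteq> (\<Union>k<N0. {c k..c k + f k \<delta>})"
    unfolding coverable_def by (rule exE)
  moreover define N where "N = max M N0"
  ultimately have c: "K \<subseteq> (\<Union>k<N. {c k..c k + f k \<delta>})" and MN: "M \<le> N" by force+
  define U where "U = (\<Union>k<M. {c k..c k + f k \<delta>})"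
  \<comment> \<open>Each interval of \<open>U\<close> is widened by \<delta> on both sides, with
    \<open>f k \<delta>\<close> raised to \<open>f 0 \<delta>\<close> so that all have the same
    length, as \<open>finite_INT_short_intervals\<close> requires.\<close>
  define V where "V = (\<Union>k<M. {c k - \<delta>..c k - \<delta> + (f 0 \<delta> + 2 * \<delta>)})"
  have V: "x \<in> V" if u: "u \<in> U" "\<bar>x - u\<bar> \<le> \<delta>" for x u
  proof -
    obtain k where k: "k < M" "u \<in> {c k..c k + f k \<delta>}" using u(1) unfolding U_def by blast
    moreover have "f k \<delta> \<le> f 0 \<delta>" by (rule admissible_antimono[OF adm \<delta>1]) simp
    ultimately have "x \<in> {c k - \<delta>..c k - \<delta> + (f 0 \<delta> + 2 * \<delta>)}" using u(2) by auto
    with k(1) show ?thesis unfolding V_def by blast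
  qed
  have "\<exists>m'. coverable (\<lambda>k. f k \<epsilon>) {m..<m'} (K - V)" for m
  proof -
    \<comment> \<open>Now \<open>{N..<n}\<close> has \<open>m\<close> elements and
      \<open>{m..<n}\<close> has \<open>N\<close>: the first is room for the intervals meeting
      \<open>U\<close>, the second for those missing it.\<close>
    define n where "n = N + m"
    \<comment> \<open>The bound \<open>f n \<epsilon>\<close> makes an interval fit at any index
      below \<open>n\<close>; the bound \<delta> keeps an interval that meets \<open>U\<close>
      inside \<open>V\<close>.\<close>
    define e where "e = min (f n \<epsilon>) \<delta>"
    have "0 < e" using admissible_pos[OF adm \<epsilon>] \<delta>1 by (simp add: e_def)
    then have "\<forall>\<^sub>F x in at_right 0. f 0 x < e"
      by (rule order_tendstoD(2)[OF admissible_tendsto[OF adm]])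
    moreover have "\<forall>\<^sub>F x in at_right 0. x \<in> {0<..<\<delta>}"
      using \<delta> by (intro eventually_at_right_real) simp
    ultimately have "\<forall>\<^sub>F x in at_right 0. f 0 x < e \<and> x \<in> {0<..<\<delta>}"
      by (rule eventually_conj)
    then obtain \<eta> where \<eta>: "f 0 \<eta> < e" "\<eta> \<in> {0<..<\<delta>}"
      using eventually_happens by force
    have \<eta>1: "\<eta> \<in> {0<..<1}" "\<eta> \<le> \<epsilon>" using \<eta>(2) \<delta> \<epsilon> by auto
    obtain N' where "coverable (\<lambda>k. f k \<eta>) {..<N'} K" using fin[OF \<eta>1(1)] by blast
    then obtain d where d: "K \<subseteq> (\<Union>k<N'. {d k..d k + f k \<eta>})"
      unfolding coverable_def by blast
    have small: "f k \<eta> \<le> e" for k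
      using admissible_antimono[OF adm \<eta>1(1), of 0 k] \<eta>(1) by simp
    have free: "e \<le> f k \<epsilon>" if "k < n" for k
      using admissible_antimono[OF adm \<epsilon>, of k n] that by (simp add: e_def)
    \<comment> \<open>Intervals with \<open>k \<ge> n\<close> keep their own index, as
      \<open>f k \<eta> \<le> f k \<epsilon>\<close>.\<close>
    have late: "coverable (\<lambda>k. f k \<epsilon>) {n..<N'} (\<Union>k\<in>{n..<N'}. {d k..d k + f k \<eta>})"
      (is "coverable _ _ ?L")
    proof -
      have "coverable (\<lambda>k. f k \<eta>) {n..<N'} ?L"
        unfolding coverable_def by (rule exI[where x = d]) simp
      then show ?thesis
        by (rule coverable_mono) (use admissible_mono[OF adm \<eta>1(1) \<epsilon> \<eta>1(2)] in auto)
    qed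
    have early: "coverable (\<lambda>k. f k \<epsilon>) T (\<Union>k\<in>J. {d k..d k + f k \<eta>})"
      if "J \<subseteq> {..<n}" "T \<subseteq> {..<n}" "card J \<le> card T" for J T
    proof (rule coverable_reindex)
      show "finite J" "finite T" using that finite_subset by blast+
      show "card J \<le> card T" by fact
      show "(\<Union>k\<in>J. {d k..d k + f k \<eta>}) \<subseteq> (\<Union>k\<in>J. {d k..d k + e})"
        by (rule UN_mono) (use small in auto)
      show "e \<le> f t \<epsilon>" if "t \<in> T" for t using free that \<open>T \<subseteq> {..<n}\<close> by auto
    qed
    define F where "F = {k. k < n \<and> {d k..d k + f k \<eta>} \<inter> U \<noteq> {}}"
    have F: "F \<subseteq> {..<n}" by (auto simp: F_def)
    have "m < card F"
    proof (rule ccontr)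
      assume "\<not> m < card F"
      then have "coverable (\<lambda>k. f k \<epsilon>) {N..<n} (\<Union>k\<in>F. {d k..d k + f k \<eta>})"
        using F by (intro early) (auto simp: n_def)
      from coverable_Un[OF this late]
      have "coverable (\<lambda>k. f k \<epsilon>) ({N..<n} \<union> {n..<N'}) ((\<Union>k\<in>F. {d k..d k + f k \<eta>}) \<union> ?L)"
        by (simp add: ivl_disj_int)
      then have 1: "coverable (\<lambda>k. f k \<epsilon>) {N..} (K \<inter> U)"
      proof (rule coverable_mono)
        show "K \<inter> U \<subseteq> (\<Union>k\<in>F. {d k..d k + f k \<eta>}) \<union> ?L"
        proof
          fix x assume x: "x \<in> K \<inter> U"
          then obtain k where "k < N'" "x \<in> {d k..d k + f k \<eta>}" using d by blast
          with x show "x \<in> (\<Union>k\<in>F. {d k..d k + f k \<eta>}) \<union> ?L"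
            by (cases "k < n") (fastforce simp: F_def)+
        qed
      qed (auto simp: n_def)
      have "K - U \<subseteq> (\<Union>k\<in>{M..<N}. {c k..c k + f k \<delta>})"
      proof
        fix x assume x: "x \<in> K - U"
        then obtain k where "k < N" "x \<in> {c k..c k + f k \<delta>}" using c by blast
        with x show "x \<in> (\<Union>k\<in>{M..<N}. {c k..c k + f k \<delta>})"
          unfolding U_def by (cases "k < M") fastforce+
      qed
      then have "coverable (\<lambda>k. f k \<delta>) {M..<N} (K - U)"
        unfolding coverable_def by (rule exI[where x = c])
      then have "coverable (\<lambda>k. f k \<epsilon>) {M..<N} (K - U)"
        by (rule coverable_mono) (use admissible_mono[OF adm \<delta>1 \<epsilon>] \<delta> in auto)
      from coverable_Un[OF this 1]
      have "coverable (\<lambda>k. f k \<epsilon>) ({M..<N} \<union> {N..}) ((K - U) \<union> (K \<inter> U))"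
        by force
      then have "coverable (\<lambda>k. f k \<epsilon>) {M..} K"
        by (rule coverable_mono) (use MN in auto)
      with neg show False ..
    qed
    \<comment> \<open>Fewer than \<open>n - m = N\<close> of the early intervals miss
      \<open>U\<close>.\<close>
    then have "card ({..<n} - F) \<le> card {m..<n}"
      using F by (simp add: card_Diff_subset finite_subset n_def)
    then have "coverable (\<lambda>k. f k \<epsilon>) {m..<n} (\<Union>k\<in>{..<n} - F. {d k..d k + f k \<eta>})"
      by (intro early) auto
    from coverable_Un[OF this late]
    have "coverable (\<lambda>k. f k \<epsilon>) ({m..<n} \<union> {n..<N'})
        ((\<Union>k\<in>{..<n} - F. {d k..d k + f k \<eta>}) \<union> ?L)"
      by (simp add: ivl_disj_int)
    then have "coverable (\<lambda>k. f k \<epsilon>) {m..<max n N'} (K - V)"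
    proof (rule coverable_mono)
      show "K - V \<subseteq> (\<Union>k\<in>{..<n} - F. {d k..d k + f k \<eta>}) \<union> ?L"
      proof
        fix x assume x: "x \<in> K - V"
        then obtain k where k: "k < N'" "x \<in> {d k..d k + f k \<eta>}" using d by blast
        have "k \<notin> F"
        proof
          assume "k \<in> F"
          then obtain u where u: "u \<in> U" "u \<in> {d k..d k + f k \<eta>}" unfolding F_def by blast
          have "f k \<eta> \<le> \<delta>" using small[of k] by (simp add: e_def)
          with k(2) u(2) have "\<bar>x - u\<bar> \<le> \<delta>" by auto
          with V[OF u(1)] x show False by blast
        qed
        with k show "x \<in> (\<Union>k\<in>{..<n} - F. {d k..d k + f k \<eta>}) \<union> ?L"
          by (cases "k < n") fastforce+
      qed
    qed (auto simp: n_def)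
    then show ?thesis ..
  qed
  then show ?thesis unfolding V_def by (intro exI[of _ "\<lambda>k. c k - \<delta>"]) blast
qed

text \<open>If this failed, \<open>coverable_blocks_away\<close> would apply for a sequence of
  \<delta> tending to 0, and the resulting blocks would yield the covering after all.\<close>

lemma microscopic_compact_coverable_tail:
  assumes adm: "admissible f" and K: "compact K" "microscopic f K" and \<epsilon>: "\<epsilon> \<in> {0<..<1}"
  shows "coverable (\<lambda>k. f k \<epsilon>) {M..} K"
proof (rule ccontr)
  assume neg: "\<not> coverable (\<lambda>k. f k \<epsilon>) {M..} K"
  have fin: "\<exists>N. coverable (\<lambda>k. f k \<eta>) {..<N} K" if \<eta>: "\<eta> \<in> {0<..<1}" for \<eta>
  proof -
    \<comment> \<open>Strict monotonicity gives \<open>f k (\<eta> / 2) < f k \<eta>\<close>, the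
      slack that \<open>coverable_compact\<close> needs.\<close>
    have half: "\<eta> / 2 \<in> {0<..<1}" using \<eta> by auto
    then have "coverable (\<lambda>k. f k (\<eta> / 2)) UNIV K"
      using K(2) microscopic_iff_coverable[OF adm] by blast
    from coverable_compact[OF K(1) this, of "\<lambda>k. f k \<eta>"]
    show ?thesis using admissible_strict_mono[OF adm half \<eta>] \<eta> by simp
  qed
  define \<delta> where "\<delta> i = \<epsilon> / real (Suc i)" for i
  have \<delta>: "\<delta> i \<in> {0<..\<epsilon>}" for i
    using \<epsilon> by (auto simp: \<delta>_def field_simps)
  have "\<delta> \<longlonglongrightarrow> 0"
    unfolding \<delta>_def by (rule LIMSEQ_Suc[OF lim_const_over_n])
  then have \<delta>0: "filterlim \<delta> (at_right 0) sequentially"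
    by (rule tendsto_imp_filterlim_at_right) (use \<delta> in simp)
  have "\<forall>i. \<exists>c. \<forall>m. \<exists>m'. coverable (\<lambda>k. f k \<epsilon>) {m..<m'}
      (K - (\<Union>k<M. {c k..c k + (f 0 (\<delta> i) + 2 * \<delta> i)}))"
    using coverable_blocks_away[OF adm \<epsilon> \<delta> fin neg] by (rule allI)
  from choice[OF this] obtain c where c: "\<And>i m. \<exists>m'. coverable (\<lambda>k. f k \<epsilon>) {m..<m'}
      (K - (\<Union>k<M. {c i k..c i k + (f 0 (\<delta> i) + 2 * \<delta> i)}))"
    by iprover
  define W where "W i = (\<Union>k<M. {c i k..c i k + (f 0 (\<delta> i) + 2 * \<delta> i)})" for i
  have "(\<lambda>i. f 0 (\<delta> i) + 2 * \<delta> i) \<longlonglongrightarrow> 0 + 2 * 0"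
    by (intro tendsto_intros filterlim_compose[OF admissible_tendsto[OF adm] \<delta>0] \<open>\<delta> \<longlonglongrightarrow> 0\<close>)
  then have finite: "finite (\<Inter>i. W i)"
    unfolding W_def by (intro finite_INT_short_intervals) simp
  \<comment> \<open>A point of \<open>K\<close> lies outside some \<open>W i\<close> or in all of
    them. The latter points are finitely many, and each takes a block of one index.\<close>
  define \<A> where "\<A> = range (\<lambda>i. K - W i) \<union> (\<lambda>x. {x}) ` (\<Inter>i. W i)"
  have "coverable (\<lambda>k. f k \<epsilon>) {M..} (\<Union>\<A>)"
  proof (rule coverable_countable_Union)
    show "countable \<A>" unfolding \<A>_def using finite by (simp add: countable_finite)
    fix A m assume "A \<in> \<A>"
    then consider i where "A = K - W i" | x where "A = {x}" unfolding \<A>_def by blast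
    then show "\<exists>m'. coverable (\<lambda>k. f k \<epsilon>) {m..<m'} A"
    proof cases
      case 1
      then show ?thesis using c unfolding W_def by blast
    next
      case (2 x)
      then have "A \<subseteq> (\<Union>k\<in>{m..<Suc m}. {x..x + f k \<epsilon>})"
        using admissible_pos[OF adm \<epsilon>, of m] by simp
      then have "coverable (\<lambda>k. f k \<epsilon>) {m..<Suc m} A"
        unfolding coverable_def by (rule exI[where x = "\<lambda>_. x"])
      then show ?thesis ..
    qed
  qed
  moreover have "K \<subseteq> \<Union>\<A>" unfolding \<A>_def by blast
  ultimately have "coverable (\<lambda>k. f k \<epsilon>) {M..} K"
    by (auto intro: coverable_mono)
  with neg show False ..
qed

section \<open>Countable unions and the \<sigma>-ideal\<close>

text \<open>Covering with late indices at \<epsilon>/2 becomes, by compactness, covering with a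
  finite late block at \<epsilon>; consecutive blocks then serve the members in turn.\<close>

lemma microscopic_countable_Union_compact:
  assumes adm: "admissible f" and "countable \<K>"
    and \<K>: "\<And>K. K \<in> \<K> \<Longrightarrow> compact K \<and> microscopic f K"
  shows "microscopic f (\<Union>\<K>)"
  unfolding microscopic_iff_coverable[OF adm]
proof
  fix \<epsilon> :: real assume \<epsilon>: "\<epsilon> \<in> {0<..<1}"
  have half: "\<epsilon> / 2 \<in> {0<..<1}" using \<epsilon> by auto
  have "coverable (\<lambda>k. f k \<epsilon>) {0..} (\<Union>\<K>)"
  proof (rule coverable_countable_Union[OF assms(2)])
    fix K m assume "K \<in> \<K>"
    then have K: "compact K" "microscopic f K" using \<K> by auto
    have "\<exists>N. coverable (\<lambda>k. f k \<epsilon>) ({m..} \<inter> {..<N}) K"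
      by (rule coverable_compact[OF K(1) microscopic_compact_coverable_tail[OF adm K half]])
        (use admissible_strict_mono[OF adm half \<epsilon>] \<epsilon> in simp)
    then show "\<exists>m'. coverable (\<lambda>k. f k \<epsilon>) {m..<m'} K"
      by (simp only: atLeastLessThan_def)
  qed
  then show "coverable (\<lambda>k. f k \<epsilon>) UNIV (\<Union>\<K>)" by simp
qed

lemma microscopic_subset: "microscopic f A \<Longrightarrow> B \<subseteq> A \<Longrightarrow> microscopic f B"
  unfolding microscopic_def by (meson subset_trans)

theorem theorem2p5:
  fixes f :: "nat \<Rightarrow> real \<Rightarrow> real"
  assumes "admissible f"
  shows "sigma_ideal (fsigma_star (Micro f))"
  unfolding sigma_ideal_def
proof (intro conjI allI impI ballI)
  have "microscopic f {}"
    using microscopic_countable_Union_compact[OF assms, of "{}"] by simp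
  then show "{} \<in> fsigma_star (Micro f)"
    unfolding fsigma_star_def Micro_def using fsigma.intros[of "\<lambda>_. {}"] by simp blast
next
  fix A B assume "A \<in> fsigma_star (Micro f)" "B \<subseteq> A"
  then show "B \<in> fsigma_star (Micro f)"
    unfolding fsigma_star_def by blast
next
  fix A :: "nat \<Rightarrow> real set"
  assume "range A \<subseteq> fsigma_star (Micro f)"
  then have "\<forall>n. \<exists>F. fsigma F \<and> microscopic f F \<and> A n \<subseteq> F"
    unfolding fsigma_star_def Micro_def by blast
  then obtain F where F: "\<And>n. fsigma (F n)" "\<And>n. microscopic f (F n)" "\<And>n. A n \<subseteq> F n"
    by metis
  have "\<forall>n. \<exists>K :: nat \<Rightarrow> real set. range K \<subseteq> Collect compact \<and> F n = \<Union>(range K)"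
    using F(1) by (simp add: fsigma_Union_compact)
  from choice[OF this] obtain K :: "nat \<Rightarrow> nat \<Rightarrow> real set"
    where "\<forall>n. range (K n) \<subseteq> Collect compact \<and> F n = \<Union>(range (K n))" ..
  then have K: "compact (K n i)" "F n = (\<Union>i. K n i)" for n i
    by (simp_all add: image_subset_iff)
  \<comment> \<open>The double family \<open>K n i\<close> is listed as one sequence, the form in
    which \<open>fsigma\<close> takes its closed sets.\<close>
  define L where "L j = case_prod K (prod_decode j)" for j
  have FL: "(\<Union>n. F n) = (\<Union>j. L j)"
  proof -
    have "(\<Union>j. L j) = (\<Union>p\<in>range prod_decode. case_prod K p)" by (simp add: L_def)
    also have "\<dots> = (\<Union>n. F n)" by (simp only: surj_prod_decode K(2)) auto
    finally show ?thesis ..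
  qed
  have L: "compact (L j)" "microscopic f (L j)" for j
  proof -
    obtain n i where "L j = K n i" by (cases "prod_decode j") (simp add: L_def)
    moreover have "K n i \<subseteq> F n" unfolding K(2) by blast
    ultimately show "compact (L j)" "microscopic f (L j)"
      using K(1) microscopic_subset[OF F(2)] by simp_all
  qed
  have "microscopic f (\<Union>n. F n)"
    unfolding FL by (rule microscopic_countable_Union_compact[OF assms]) (use L in auto)
  moreover have "fsigma (\<Union>n. F n)"
    unfolding FL using L(1) by (intro fsigma.intros compact_imp_closed)
  moreover have "(\<Union>n. A n) \<subseteq> (\<Union>n. F n)" using F(3) by blast
  ultimately show "(\<Union>n. A n) \<in> fsigma_star (Micro f)"
    unfolding fsigma_star_def Micro_def by blast
qed

end
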